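(* Let $k_G>0$, let $r$ be a smooth function describing a closed standoff curve $d=r(\gamma)$ in polar coordinates, let $\gamma\in\mathbb{R}$, $d>0$, and set $a=a(\gamma,d)=r'(\gamma)/d$. Let $\sigma(e)=-\tanh(k_G e)$ for $e\in\mathbb{R}$, and define $$\alpha:=\tan^{-1}(a),\qquad \gamma_\lambda(e):=\cos^{-1}\!\left(-\frac{\sigma(e)}{\sqrt{1+a^2}}\right)\in[0,\pi].$$ Then for every $e\in\mathbb{R}$ the equation $$\cos\lambda-a\sin\lambda=-\sigma(e)$$ in the unknown $\lambda$ admits a real solution $\lambda=\lambda(e,\gamma,d)$, and it has the two solution branches $$\lambda_d(e)=-\alpha+s\,\gamma_\lambda(e),\qquad s\in\{+1,-1\}.$$ Moreover: (1) (Existence for all $e$.) $\gamma_\lambda(e)$ is well defined for all $e\in\mathbb{R}$, i.e. $$-\frac{\sigma(e)}{\sqrt{1+a^2}}\in(-1,1)\quad\text{for all } e\in\mathbb{R},$$ and hence $\lambda_d(e)$ exists for all $e\in\mathbb{R}$. (2) (Boundedness and smoothness.) Each branch $\lambda_d$ is continuous on $\mathbb{R}$ and continuously differentiable in $e$ with globally bounded slope; in particular, for all $e\in\mathbb{R}$ (the derivative being taken with $a$ held fixed), $$\left|\frac{d\lambda_d}{de}\right|=\left|\frac{d\gamma_\lambda}{de}\right|\le\frac{k_G}{\sqrt{1+a^2}}.$$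
   Context: A vehicle moves in the plane; $d>0$ is its range from the origin, $\gamma$ is its line-of-sight (polar) angle, and $e$ is the standoff error relative to the curve $d=r(\gamma)$. The look angle $\lambda$ is the course angle minus $\gamma$. In the algebraic equation of the claim, $e$ is treated as an independent real variable and $a=r'(\gamma)/d$ as a fixed real parameter. Here $\cos^{-1}:[-1,1]\to[0,\pi]$ and $\tan^{-1}:\mathbb{R}\to(-\pi/2,\pi/2)$ are the principal inverse functions. *)

theory Defs
  imports "HOL-Analysis.Analysis"
begin

definition smooth_real :: "(real \<Rightarrow> real) \<Rightarrow> bool" where
  "smooth_real f \<longleftrightarrow> (\<forall>n x. (deriv ^^ n) f differentiable (at x))"

text \<open>
  The polar angle is an unwrapped real number; the curve closes up after some
  positive number \<open>m\<close> of full turns (\<open>m = 1\<close> for a curve winding once around the origin).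
\<close>

definition closed_polar_curve :: "(real \<Rightarrow> real) \<Rightarrow> bool" where
  "closed_polar_curve r \<longleftrightarrow> (\<exists>m::nat. m > 0 \<and> (\<forall>\<theta>. r (\<theta> + 2 * pi * real m) = r \<theta>))"

definition sigma_k :: "real \<Rightarrow> real \<Rightarrow> real" where
  "sigma_k k e = - tanh (k * e)"

definition alpha :: "real \<Rightarrow> real" where
  "alpha a = arctan a"

definition gamma_lam :: "real \<Rightarrow> real \<Rightarrow> real \<Rightarrow> real" where
  "gamma_lam k a e = arccos (- sigma_k k e / sqrt (1 + a\<^sup>2))"

text \<open>The sign \<open>s\<close>, which is \<open>1\<close> or \<open>-1\<close>, selects the branch.\<close>

definition lam_d :: "real \<Rightarrow> real \<Rightarrow> real \<Rightarrow> real \<Rightarrow> real" where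
  "lam_d s k a e = - alpha a + s * gamma_lam k a e"

end

theory Submission imports Defs begin

text \<open>
  With \<open>R = sqrt (1 + a\<^sup>2)\<close>, the phase shift \<open>cos l - a * sin l = R * cos (l + arctan a)\<close> turns the
  equation into \<open>cos (l + arctan a) = tanh (k * e) / R\<close>, whose right-hand side lies in \<open>(-1, 1)\<close>.
  Differentiating the arc cosine gives the slope \<open>k / R * (1 - t\<^sup>2) / sqrt (1 - (t / R)\<^sup>2)\<close> up to sign,
  where \<open>t = tanh (k * e)\<close>, and \<open>1 - t\<^sup>2 \<le> 1 - (t / R)\<^sup>2 \<le> sqrt (1 - (t / R)\<^sup>2)\<close>.
\<close>

lemma sqrt_one_plus_sq_ge_1: "1 \<le> sqrt (1 + (a::real)\<^sup>2)"
  by simp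

text \<open>Expand \<open>cos (l + arctan a)\<close> by the addition formula:
  \<open>cos (arctan a)\<close> and \<open>sin (arctan a)\<close> are 1 and \<open>a\<close> divided
  by the root, so the factor in front cancels both denominators.\<close>

lemma cos_minus_mult_sin:
  fixes a l :: real
  shows "cos l - a * sin l = sqrt (1 + a\<^sup>2) * cos (l + arctan a)"
proof -
  have "sqrt (1 + a\<^sup>2) \<noteq> 0"
    using sqrt_one_plus_sq_ge_1[of a] by linarith
  then show ?thesis
    by (simp add: cos_add cos_arctan sin_arctan field_simps)
qed

lemma abs_tanh_less_1: "\<bar>tanh (x::real)\<bar> < 1"
  using tanh_real_lt_1[of x] tanh_real_gt_neg1[of x] by linarith

text \<open>Strictness matters: it keeps the argument off the endpoints -1 and 1, where
  \<open>arccos\<close> is defined but not differentiable.\<close>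

lemma abs_tanh_over_sqrt_less_1:
  fixes x a :: real
  shows "\<bar>tanh x / sqrt (1 + a\<^sup>2)\<bar> < 1"
proof -
  have "\<bar>tanh x\<bar> < sqrt (1 + a\<^sup>2)"
    using abs_tanh_less_1[of x] sqrt_one_plus_sq_ge_1[of a] by linarith
  moreover have "0 < sqrt (1 + a\<^sup>2)"
    using sqrt_one_plus_sq_ge_1[of a] by linarith
  ultimately show ?thesis
    by (simp add: abs_divide pos_divide_less_eq)
qed

text \<open>The derivative of \<open>gamma_lam k a\<close> in \<open>e\<close> with \<open>a\<close>
  fixed, as the chain rule yields it: the inner numerator is the slope of
  \<open>tanh (k * e) / sqrt (1 + a\<^sup>2)\<close>, the minus sign and the outer root come from
  \<open>arccos\<close>. A closed form lets continuity and the bound be proved without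
  derivatives.\<close>

definition gamma_slope :: "real \<Rightarrow> real \<Rightarrow> real \<Rightarrow> real" where
  "gamma_slope k a e =
     - (k * (1 - (tanh (k * e))\<^sup>2) / sqrt (1 + a\<^sup>2)) / sqrt (1 - (tanh (k * e) / sqrt (1 + a\<^sup>2))\<^sup>2)"

lemma one_minus_sq_pos:
  fixes u :: real
  assumes "\<bar>u\<bar> < 1"
  shows "0 < 1 - u\<^sup>2"
  using assms by (simp add: abs_square_less_1)

lemma has_real_derivative_gamma_lam:
  "(gamma_lam k a has_real_derivative gamma_slope k a e) (at e)"
proof -
  have u: "-1 < tanh (k * e) / sqrt (1 + a\<^sup>2)" "tanh (k * e) / sqrt (1 + a\<^sup>2) < 1"
    using abs_tanh_over_sqrt_less_1[of "k * e" a] by linarith+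
  have "((\<lambda>e. tanh (k * e) / sqrt (1 + a\<^sup>2)) has_real_derivative
          k * (1 - (tanh (k * e))\<^sup>2) / sqrt (1 + a\<^sup>2)) (at e)"
    using sqrt_one_plus_sq_ge_1[of a]
    by (intro DERIV_cdivide) (auto intro!: derivative_eq_intros)
  from DERIV_chain2[OF DERIV_arccos[OF u] this]
  show ?thesis
    by (simp add: gamma_lam_def[abs_def] sigma_k_def gamma_slope_def divide_inverse mult.commute)
qed

lemma continuous_on_gamma_slope: "continuous_on UNIV (gamma_slope k a)"
proof -
  have "sqrt (1 - (tanh (k * e) / sqrt (1 + a\<^sup>2))\<^sup>2) \<noteq> 0" for e
    using one_minus_sq_pos[OF abs_tanh_over_sqrt_less_1[of "k * e" a]] by simp
  moreover have "sqrt (1 + a\<^sup>2) \<noteq> 0"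
    using sqrt_one_plus_sq_ge_1[of a] by linarith
  ultimately show ?thesis
    unfolding gamma_slope_def[abs_def] by (intro continuous_intros) auto
qed

lemma abs_gamma_slope_le:
  assumes "0 \<le> k"
  shows "\<bar>gamma_slope k a e\<bar> \<le> k / sqrt (1 + a\<^sup>2)"
proof -
  define t R where "t = tanh (k * e)" and "R = sqrt (1 + a\<^sup>2)"
  define q where "q = 1 - (t / R)\<^sup>2"
  have R: "1 \<le> R" unfolding R_def by simp
  have q: "0 < q"
    unfolding q_def t_def R_def by (rule one_minus_sq_pos[OF abs_tanh_over_sqrt_less_1])
  have p: "0 < 1 - t\<^sup>2"
    unfolding t_def by (rule one_minus_sq_pos[OF abs_tanh_less_1])
  \<comment> \<open>Dividing by \<open>R\<close>, which is at least 1, can only shrink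
    \<open>t\<close>; squaring then compares the numerator with \<open>q\<close>.\<close>
  have "\<bar>t / R\<bar> \<le> \<bar>t\<bar>"
    using R by (simp add: abs_divide divide_le_eq mult_le_cancel_left1)
  then have "1 - t\<^sup>2 \<le> q"
    unfolding q_def using abs_le_square_iff[of "t / R" t] by simp
  \<comment> \<open>Since \<open>q\<close> lies in (0, 1], its square is at most
    \<open>q\<close>.\<close>
  also have "q \<le> sqrt q"
    using q by (intro real_le_rsqrt) (simp_all add: q_def power2_eq_square mult_le_one mult_left_le)
  finally have "(1 - t\<^sup>2) / sqrt q \<le> 1"
    using q by simp
  then have "k / R * ((1 - t\<^sup>2) / sqrt q) \<le> k / R"
    using assms R by (intro mult_left_le) auto
  \<comment> \<open>All factors are nonnegative, so the absolute value only removes the leading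
    minus sign.\<close>
  moreover have "\<bar>gamma_slope k a e\<bar> = k / R * ((1 - t\<^sup>2) / sqrt q)"
    using assms R q p
    by (simp add: gamma_slope_def abs_divide abs_mult flip: t_def R_def q_def)
  ultimately show ?thesis
    by (simp add: R_def)
qed

lemma has_real_derivative_lam_d:
  "(lam_d s k a has_real_derivative s * gamma_slope k a e) (at e)"
  unfolding lam_d_def[abs_def]
  by (auto intro!: derivative_eq_intros has_real_derivative_gamma_lam)

lemma C1_differentiable_onI_real:
  fixes f :: "real \<Rightarrow> real"
  assumes "\<And>x. x \<in> S \<Longrightarrow> (f has_real_derivative D x) (at x)" "continuous_on S D"
  shows "f C1_differentiable_on S"
  using assms unfolding C1_differentiable_on_def
  by (auto simp: has_real_derivative_iff_has_vector_derivative)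

text \<open>Writing the right-hand side as a cosine too reduces solving for \<open>l\<close> to
  comparing two angles with equal cosine.\<close>

lemma look_angle_eq_iff:
  "cos l - a * sin l = - sigma_k k e \<longleftrightarrow> cos (l + arctan a) = cos (gamma_lam k a e)"
proof -
  have cos_gamma: "cos (gamma_lam k a e) = tanh (k * e) / sqrt (1 + a\<^sup>2)"
    using abs_tanh_over_sqrt_less_1[of "k * e" a]
    by (simp add: gamma_lam_def sigma_k_def cos_arccos_abs)
  have "sqrt (1 + a\<^sup>2) > 0"
    using sqrt_one_plus_sq_ge_1[of a] by linarith
  then show ?thesis
    unfolding cos_minus_mult_sin sigma_k_def cos_gamma by (auto simp: eq_divide_eq mult.commute)
qed

text \<open>The shift by \<open>alpha a\<close> cancels, and evenness of the cosine makes both signs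
  work.\<close>

lemma look_angle_lam_d:
  assumes "s \<in> {1, -1}"
  shows "cos (lam_d s k a e) - a * sin (lam_d s k a e) = - sigma_k k e"
  using assms unfolding look_angle_eq_iff by (auto simp: lam_d_def alpha_def)

text \<open>Completeness of the two branches: equal cosines force the angles to agree up to sign and
  full turns.\<close>

lemma look_angle_imp_lam_d:
  assumes "cos l - a * sin l = - sigma_k k e"
  shows "\<exists>s\<in>{1, -1}. \<exists>n::int. l = lam_d s k a e + 2 * pi * of_int n"
proof -
  from assms obtain n where "n \<in> \<int>"
    and "l + arctan a = gamma_lam k a e + 2 * n * pi \<or> l + arctan a = - gamma_lam k a e + 2 * n * pi"
    unfolding look_angle_eq_iff cos_eq by blast
  \<comment> \<open>\<open>cos_eq\<close> supplies a real \<open>n\<close> in the set of integers;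
    the goal quantifies over the type \<open>int\<close>.\<close>
  moreover then obtain m :: int where "n = of_int m"
    by (auto elim: Ints_cases)
  ultimately have "l = lam_d 1 k a e + 2 * pi * of_int m \<or> l = lam_d (-1) k a e + 2 * pi * of_int m"
    by (auto simp: lam_d_def alpha_def algebra_simps)
  then show ?thesis by blast
qed

theorem theorem1:
  fixes k\<^sub>G d \<gamma> a :: real and r :: "real \<Rightarrow> real"
  assumes k_pos: "k\<^sub>G > 0"
    and r_smooth: "smooth_real r"
    and r_closed: "closed_polar_curve r"
    and d_pos: "d > 0"
    and a_eq: "a = deriv r \<gamma> / d"
  shows
    "(\<forall>e. \<exists>l. cos l - a * sin l = - sigma_k k\<^sub>G e) \<and>
     (\<forall>e. \<forall>s\<in>{1, -1}. cos (lam_d s k\<^sub>G a e) - a * sin (lam_d s k\<^sub>G a e) = - sigma_k k\<^sub>G e) \<and>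
     (\<forall>e l. cos l - a * sin l = - sigma_k k\<^sub>G e \<longrightarrow>
        (\<exists>s\<in>{1, -1}. \<exists>n::int. l = lam_d s k\<^sub>G a e + 2 * pi * of_int n)) \<and>
     (\<forall>e. - sigma_k k\<^sub>G e / sqrt (1 + a\<^sup>2) \<in> {-1<..<1} \<and> gamma_lam k\<^sub>G a e \<in> {0..pi}) \<and>
     gamma_lam k\<^sub>G a C1_differentiable_on UNIV \<and>
     (\<forall>s\<in>{1, -1}.
        continuous_on UNIV (lam_d s k\<^sub>G a) \<and>
        lam_d s k\<^sub>G a C1_differentiable_on UNIV \<and>
        bounded (range (deriv (lam_d s k\<^sub>G a))) \<and>
        (\<forall>e. \<bar>deriv (lam_d s k\<^sub>G a) e\<bar> = \<bar>deriv (gamma_lam k\<^sub>G a) e\<bar> \<and>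
             \<bar>deriv (gamma_lam k\<^sub>G a) e\<bar> \<le> k\<^sub>G / sqrt (1 + a\<^sup>2)))"
proof (intro conjI allI ballI impI)
  show "\<exists>l. cos l - a * sin l = - sigma_k k\<^sub>G e" for e
    using look_angle_lam_d[of 1] by blast
  show "cos (lam_d s k\<^sub>G a e) - a * sin (lam_d s k\<^sub>G a e) = - sigma_k k\<^sub>G e"
    if "s \<in> {1, -1}" for e s
    using that by (rule look_angle_lam_d)
  show "\<exists>s\<in>{1, -1}. \<exists>n::int. l = lam_d s k\<^sub>G a e + 2 * pi * of_int n"
    if "cos l - a * sin l = - sigma_k k\<^sub>G e" for e l
    using that by (rule look_angle_imp_lam_d)
  have u: "\<bar>- sigma_k k\<^sub>G e / sqrt (1 + a\<^sup>2)\<bar> < 1" for e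
    using abs_tanh_over_sqrt_less_1[of "k\<^sub>G * e" a] by (simp add: sigma_k_def)
  show "- sigma_k k\<^sub>G e / sqrt (1 + a\<^sup>2) \<in> {-1<..<1}" for e
    using u[of e] unfolding abs_less_iff greaterThanLessThan_iff by linarith
  show "gamma_lam k\<^sub>G a e \<in> {0..pi}" for e
    using u[of e] arccos_bounded[of "- sigma_k k\<^sub>G e / sqrt (1 + a\<^sup>2)"]
    unfolding gamma_lam_def abs_less_iff atLeastAtMost_iff by linarith
  show "gamma_lam k\<^sub>G a C1_differentiable_on UNIV"
    using has_real_derivative_gamma_lam continuous_on_gamma_slope
    by (rule C1_differentiable_onI_real)
  have deriv_gamma: "deriv (gamma_lam k\<^sub>G a) = gamma_slope k\<^sub>G a"
    using DERIV_imp_deriv[OF has_real_derivative_gamma_lam] by blast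
  show bound: "\<bar>deriv (gamma_lam k\<^sub>G a) e\<bar> \<le> k\<^sub>G / sqrt (1 + a\<^sup>2)" for e
    unfolding deriv_gamma using k_pos by (intro abs_gamma_slope_le) simp
  fix s :: real assume s: "s \<in> {1, -1}"
  have deriv_lam: "deriv (lam_d s k\<^sub>G a) = (\<lambda>e. s * gamma_slope k\<^sub>G a e)"
    using DERIV_imp_deriv[OF has_real_derivative_lam_d] by blast
  show "lam_d s k\<^sub>G a C1_differentiable_on UNIV"
    using has_real_derivative_lam_d
    by (rule C1_differentiable_onI_real) (intro continuous_intros continuous_on_gamma_slope)
  then show "continuous_on UNIV (lam_d s k\<^sub>G a)"
    by (rule C1_differentiable_imp_continuous_on)
  show eq: "\<bar>deriv (lam_d s k\<^sub>G a) e\<bar> = \<bar>deriv (gamma_lam k\<^sub>G a) e\<bar>" for e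
    unfolding deriv_lam deriv_gamma using s by auto
  \<comment> \<open>The pointwise bound does not depend on \<open>e\<close>, so it bounds the whole
    range.\<close>
  show "bounded (range (deriv (lam_d s k\<^sub>G a)))"
    using bound eq by (intro boundedI[of _ "k\<^sub>G / sqrt (1 + a\<^sup>2)"]) auto
qed

end
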